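(* Let $S$ be a non-empty subset of $\mathbb{Z}_{\ge2}$. Write $\mathcal{O}^{EP}_S(n)$ for the outcome of $n$ tokens in $\mathcal{L}\mathcal{R}$-Subtraction Nim with removable set $S$, and $\mathcal{O}^{SN}_S(n)$ for the outcome of $n$ tokens in normal-play Subtraction Nim with removable set $S$. Assume that for every $n\in\mathbb{Z}_{\ge0}$, $\mathcal{O}^{EP}_S(n)=\mathcal{R}$ implies $\mathcal{O}^{SN}_S(n)=\mathcal{P}$. Then for every $n\in\mathbb{Z}_{\ge0}$: (1) if $\mathcal{O}^{EP}_S(n)=\mathcal{P}$ then $\mathcal{O}^{SN}_S(n)=\mathcal{P}$; (2) if $\mathcal{O}^{EP}_S(n)=\mathcal{N}$ then $\mathcal{O}^{SN}_S(n)=\mathcal{N}$.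
   Context: In both games, a position is a number $n\in\mathbb{Z}_{\ge0}$ of tokens, players Left and Right alternate moves, and a move from $n$ removes $s\in S$ tokens with $s\le n$. In $\mathcal{L}\mathcal{R}$-Subtraction Nim, when the player to move has no move (i.e. $n<\min S$) the game ends and Left wins if $n$ is even, Right wins if $n$ is odd. In normal-play Subtraction Nim, the player who cannot move loses. Outcomes: $\mathcal{L}$ (resp. $\mathcal{R}$) if Left (resp. Right) has a winning strategy from $n$ both moving first and moving second; $\mathcal{N}$ if the first player (whichever) has a winning strategy; $\mathcal{P}$ if the second player (whichever) has a winning strategy. *)

theory Defs
  imports Main
begin

datatype player = Left | Right

fun opponent :: "player \<Rightarrow> player" where
  "opponent Left = Right"
| "opponent Right = Left"

definition options :: "nat set \<Rightarrow> nat \<Rightarrow> nat set" where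
  "options S n = {s \<in> S. s \<le> n}"

text \<open>
  A winning convention \<open>w\<close> maps the player to move and the number of tokens at a position
  without options to the player who wins there.
\<close>

type_synonym convention = "player \<Rightarrow> nat \<Rightarrow> player"

definition EP :: convention where
  "EP p n = (if even n then Left else Right)"

definition SN :: convention where
  "SN p n = opponent p"

text \<open>
  A (partial) play is recorded as the list of the numbers of tokens removed, in chronological
  order.
\<close>

fun legal_play :: "nat set \<Rightarrow> nat \<Rightarrow> nat list \<Rightarrow> bool" where
  "legal_play S n [] \<longleftrightarrow> True"
| "legal_play S n (s # ss) \<longleftrightarrow> s \<in> options S n \<and> legal_play S (n - s) ss"

definition mover :: "player \<Rightarrow> nat \<Rightarrow> player" where
  "mover p k = (if even k then p else opponent p)"

text \<open>
  A strategy may depend on the whole history. In \<open>consistent X p \<sigma> ss\<close>, player \<open>X\<close> uses \<open>\<sigma>\<close>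
  and player \<open>p\<close> makes the first move.
\<close>

type_synonym strategy = "nat list \<Rightarrow> nat"

definition consistent :: "player \<Rightarrow> player \<Rightarrow> strategy \<Rightarrow> nat list \<Rightarrow> bool" where
  "consistent X p \<sigma> ss \<longleftrightarrow> (\<forall>k < length ss. mover p k = X \<longrightarrow> ss ! k = \<sigma> (take k ss))"

text \<open>
  The strategy must prescribe a legal move whenever \<open>X\<close> has to move and can, and \<open>X\<close> must win
  every finished play. Infinite plays are not considered: there are none when \<open>0 \<notin> S\<close>.
\<close>

definition winning_strategy ::
  "convention \<Rightarrow> nat set \<Rightarrow> player \<Rightarrow> player \<Rightarrow> nat \<Rightarrow> strategy \<Rightarrow> bool" where
  "winning_strategy w S X p n \<sigma> \<longleftrightarrow>
    (\<forall>ss. legal_play S n ss \<and> consistent X p \<sigma> ss \<longrightarrow>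
      (let m = n - sum_list ss; q = mover p (length ss) in
        if options S m = {} then w q m = X
        else q = X \<longrightarrow> \<sigma> ss \<in> options S m))"

text \<open>\<open>wins w S X p n\<close>: player \<open>X\<close> can force a win from \<open>n\<close> tokens if \<open>p\<close> moves first.\<close>

definition wins :: "convention \<Rightarrow> nat set \<Rightarrow> player \<Rightarrow> player \<Rightarrow> nat \<Rightarrow> bool" where
  "wins w S X p n \<longleftrightarrow> (\<exists>\<sigma>. winning_strategy w S X p n \<sigma>)"

datatype outcome = \<L> | \<R> | \<N> | \<P>

fun has_outcome :: "convention \<Rightarrow> nat set \<Rightarrow> nat \<Rightarrow> outcome \<Rightarrow> bool" where
  "has_outcome w S n \<L> \<longleftrightarrow> (\<forall>p. wins w S Left p n)"
| "has_outcome w S n \<R> \<longleftrightarrow> (\<forall>p. wins w S Right p n)"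
| "has_outcome w S n \<N> \<longleftrightarrow> (\<forall>p. wins w S p p n)"
| "has_outcome w S n \<P> \<longleftrightarrow> (\<forall>p. wins w S (opponent p) p n)"

text \<open>
  The outcome is well defined whenever \<open>0 \<notin> S\<close>; see \<open>outcome_eq_iff\<close> below.
\<close>

definition outcome :: "convention \<Rightarrow> nat set \<Rightarrow> nat \<Rightarrow> outcome" where
  "outcome w S n = (THE c. has_outcome w S n c)"

lemma opponent_opponent [simp]: "opponent (opponent p) = p"
  by (cases p) auto

lemma opponent_neq [simp]: "opponent p \<noteq> p" "p \<noteq> opponent p"
  by (cases p; simp)+

lemma neq_iff_opponent: "p \<noteq> q \<longleftrightarrow> q = opponent p"
  by (cases p; cases q) auto

lemma all_player: "(\<forall>p. Q p) \<longleftrightarrow> Q Left \<and> Q Right"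
  by (metis player.exhaust)

lemma mover_0 [simp]: "mover p 0 = p"
  by (simp add: mover_def)

lemma mover_Suc [simp]: "mover p (Suc k) = mover (opponent p) k"
  by (simp add: mover_def)

lemma consistent_Nil [simp]: "consistent X p \<sigma> []"
  by (simp add: consistent_def)

lemma consistent_Cons [simp]:
  "consistent X p \<sigma> (s # ss) \<longleftrightarrow>
    (p = X \<longrightarrow> s = \<sigma> []) \<and> consistent X (opponent p) (\<lambda>h. \<sigma> (s # h)) ss"
  by (simp add: consistent_def All_less_Suc2)

lemma winning_strategy_step:
  "winning_strategy w S X p n \<sigma> \<longleftrightarrow>
    (if options S n = {} then w p n = X else p = X \<longrightarrow> \<sigma> [] \<in> options S n) \<and>
    (\<forall>s \<in> options S n. (p = X \<longrightarrow> s = \<sigma> []) \<longrightarrow>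
      winning_strategy w S X (opponent p) (n - s) (\<lambda>h. \<sigma> (s # h)))"
proof -
  have split_list: "(\<forall>ss. Q ss) \<longleftrightarrow> Q [] \<and> (\<forall>s ss. Q (s # ss))" for Q :: "nat list \<Rightarrow> bool"
    by (metis list.exhaust)
  show ?thesis
    unfolding winning_strategy_def Let_def
    by (subst split_list) (simp add: Ball_def, blast)
qed

lemma wins_step:
  "wins w S X p n \<longleftrightarrow>
    (if options S n = {} then w p n = X
     else if p = X then \<exists>s \<in> options S n. wins w S X (opponent p) (n - s)
     else \<forall>s \<in> options S n. wins w S X (opponent p) (n - s))"
proof (cases "options S n = {}")
  case True
  then show ?thesis
    by (simp add: wins_def winning_strategy_step[of w S X p n])
next
  case ne: False
  show ?thesis
  proof (cases "p = X")
    case True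
    have "wins w S X p n" if s: "s \<in> options S n" "wins w S X (opponent p) (n - s)" for s
    proof -
      obtain \<tau> where "winning_strategy w S X (opponent p) (n - s) \<tau>"
        using s by (auto simp: wins_def)
      then have "winning_strategy w S X p n (\<lambda>h. case h of [] \<Rightarrow> s | _ # h' \<Rightarrow> \<tau> h')"
        using s ne True by (subst winning_strategy_step) auto
      then show ?thesis by (auto simp: wins_def)
    qed
    moreover have "\<exists>s \<in> options S n. wins w S X (opponent p) (n - s)" if "wins w S X p n"
      using that ne True winning_strategy_step[of w S X p n] unfolding wins_def by auto
    ultimately show ?thesis using ne True by auto
  next
    case False
    have "wins w S X p n" if "\<forall>s \<in> options S n. wins w S X (opponent p) (n - s)"
    proof -
      obtain \<tau> where
        "\<forall>s \<in> options S n. winning_strategy w S X (opponent p) (n - s) (\<tau> s)"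
        using \<open>\<forall>s \<in> options S n. _ s\<close> unfolding wins_def by metis
      then have "winning_strategy w S X p n (\<lambda>h. \<tau> (hd h) (tl h))"
        using ne False by (subst winning_strategy_step) auto
      then show ?thesis by (auto simp: wins_def)
    qed
    moreover have "\<forall>s \<in> options S n. wins w S X (opponent p) (n - s)" if "wins w S X p n"
      using that ne False winning_strategy_step[of w S X p n] unfolding wins_def by auto
    ultimately show ?thesis using ne False by auto
  qed
qed

lemma wins_opponent_iff:
  assumes "0 \<notin> S"
  shows "wins w S (opponent X) p n \<longleftrightarrow> \<not> wins w S X p n"
proof (induction n arbitrary: p rule: less_induct)
  case (less n)
  have "n - s < n" if "s \<in> options S n" for s
    using that assms by (cases "s = 0") (auto simp: options_def)
  then have IH: "wins w S (opponent X) q (n - s) \<longleftrightarrow> \<not> wins w S X q (n - s)"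
    if "s \<in> options S n" for s q
    using less that by blast
  show ?case
    using IH neq_iff_opponent[of X p] neq_iff_opponent[of X "w p n"]
    by (subst (1 2) wins_step) auto
qed

lemma ex1_has_outcome:
  assumes "0 \<notin> S"
  shows "\<exists>!c. has_outcome w S n c"
proof -
  have *: "wins w S Right p n \<longleftrightarrow> \<not> wins w S Left p n" for p
    using wins_opponent_iff[OF assms, of w Left] by simp
  have ex: "\<exists>c. has_outcome w S n c"
  proof (cases "wins w S Left Left n"; cases "wins w S Left Right n")
    assume "wins w S Left Left n" "wins w S Left Right n"
    then have "has_outcome w S n \<L>" by (simp add: all_player)
    then show ?thesis ..
  next
    assume "wins w S Left Left n" "\<not> wins w S Left Right n"
    then have "has_outcome w S n \<N>" by (simp add: all_player *)
    then show ?thesis ..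
  next
    assume "\<not> wins w S Left Left n" "wins w S Left Right n"
    then have "has_outcome w S n \<P>" by (simp add: all_player *)
    then show ?thesis ..
  next
    assume "\<not> wins w S Left Left n" "\<not> wins w S Left Right n"
    then have "has_outcome w S n \<R>" by (simp add: all_player *)
    then show ?thesis ..
  qed
  have "c = d" if "has_outcome w S n c" "has_outcome w S n d" for c d
    using that * by (cases c; cases d; simp add: all_player)
  with ex show ?thesis by blast
qed

lemma outcome_eq_iff:
  assumes "0 \<notin> S"
  shows "outcome w S n = c \<longleftrightarrow> has_outcome w S n c"
  using ex1_has_outcome[OF assms, of w n] unfolding outcome_def
  by (metis theI')

end

theory Submission
  imports Defs
begin

text \<open>Strong induction on \<open>n\<close> proves both claims together. If \<open>n\<close> is
  \<open>\<P>\<close> under \<open>EP\<close>, every option is \<open>\<N>\<close> there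
  (\<open>outcome_P_option\<close>), hence \<open>\<N>\<close> under \<open>SN\<close> by induction,
  so \<open>n\<close> is \<open>\<P>\<close> under \<open>SN\<close>. If \<open>n\<close> is
  \<open>\<N>\<close> under \<open>EP\<close>, it has a move, and Right's winning move leads to an
  option that is \<open>\<R>\<close> or \<open>\<P>\<close> (\<open>outcome_N_option\<close>). That
  option is \<open>\<P>\<close> under \<open>SN\<close>, by the hypothesis or by induction, so
  \<open>n\<close> is \<open>\<N>\<close> under \<open>SN\<close>.\<close>

context
  fixes w :: convention and S :: "nat set" and n :: nat
  assumes zero: "0 \<notin> S"
begin

text \<open>Determinacy: an outcome is thus fixed by whether Left wins for each of the two
  starters.\<close>

lemma wins_Right_iff: "wins w S Right p m \<longleftrightarrow> \<not> wins w S Left p m"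
  using wins_opponent_iff[OF zero, of w Left] by simp

lemmas outcome_defs = outcome_eq_iff[OF zero] all_player wins_Right_iff

lemma outcome_P_option:
  assumes "outcome w S n = \<P>" and s: "s \<in> options S n"
  shows "outcome w S (n - s) = \<N>"
proof -
  have ne: "options S n \<noteq> {}"
    using s by auto
  have "\<not> wins w S Left Left n" "wins w S Left Right n"
    using assms(1) by (simp_all add: outcome_defs)
  then have "\<not> wins w S Left Right (n - s)" "wins w S Left Left (n - s)"
    using s ne wins_step[of w S Left Left n] wins_step[of w S Left Right n] by auto
  then show ?thesis
    by (simp add: outcome_defs)
qed

lemma outcome_N_option:
  assumes "outcome w S n = \<N>" and ne: "options S n \<noteq> {}"
  obtains s where "s \<in> options S n" "outcome w S (n - s) \<in> {\<R>, \<P>}"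
proof -
  \<comment> \<open>Right's winning move is the one followed: Left's would lead to
    \<open>\<L>\<close> or \<open>\<P>\<close>, and the main hypothesis says nothing about
    \<open>\<L>\<close>.\<close>
  have "\<not> wins w S Left Right n"
    using assms(1) by (simp add: outcome_defs)
  then obtain s where "s \<in> options S n" "\<not> wins w S Left Left (n - s)"
    using ne wins_step[of w S Left Right n] by auto
  with that show thesis
    \<comment> \<open>Left loses moving first from \<open>n - s\<close>; the result with Right
      moving first separates \<open>\<P>\<close> from \<open>\<R>\<close>.\<close>
    by (cases "wins w S Left Right (n - s)") (auto simp: outcome_defs)
qed

end

text \<open>Parity alone decides a terminal position, whoever is to move.\<close>

lemma EP_outcome_terminal:
  assumes "0 \<notin> S" and "options S n = {}"
  shows "outcome EP S n \<in> {\<L>, \<R>}"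
  using assms(2)
  by (cases "even n")
    (auto simp: outcome_eq_iff[OF assms(1)] EP_def wins_step[of EP S _ _ n])

text \<open>Terminal positions are included: the premise is then vacuous and the player to move
  loses.\<close>

lemma SN_outcome_P:
  assumes "0 \<notin> S" and "\<And>s. s \<in> options S n \<Longrightarrow> outcome SN S (n - s) = \<N>"
  shows "outcome SN S n = \<P>"
  using assms(2)
  by (auto simp: outcome_eq_iff[OF assms(1)] SN_def wins_step[of SN S _ _ n])

lemma SN_outcome_N:
  assumes "0 \<notin> S" and "s \<in> options S n" and "outcome SN S (n - s) = \<P>"
  shows "outcome SN S n = \<N>"
proof -
  have "wins SN S p p n" for p
    using assms(2,3) wins_step[of SN S p p n]
    \<comment> \<open>After the move, \<open>opponent p\<close> starts from a \<open>\<P>\<close>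
      position, so \<open>p\<close> wins as second player.\<close>
    by (auto simp: outcome_eq_iff[OF assms(1)]) (metis opponent_opponent)+
  then show ?thesis
    by (simp add: outcome_eq_iff[OF assms(1)])
qed

theorem theorem13:
  fixes S :: "nat set"
  assumes "S \<noteq> {}" and "S \<subseteq> {2..}"
    and "\<And>n. outcome EP S n = \<R> \<Longrightarrow> outcome SN S n = \<P>"
  shows "\<forall>n. (outcome EP S n = \<P> \<longrightarrow> outcome SN S n = \<P>) \<and>
             (outcome EP S n = \<N> \<longrightarrow> outcome SN S n = \<N>)"
proof
  fix n
  have zero: "0 \<notin> S"
    using assms(2) by auto
  show "(outcome EP S n = \<P> \<longrightarrow> outcome SN S n = \<P>) \<and>
        (outcome EP S n = \<N> \<longrightarrow> outcome SN S n = \<N>)"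
  proof (induction n rule: less_induct)
    case (less n)
    have smaller: "n - s < n" if "s \<in> options S n" for s
      using that zero by (cases "s = 0") (auto simp: options_def)
    have "outcome SN S n = \<P>" if "outcome EP S n = \<P>"
      using SN_outcome_P[OF zero] outcome_P_option[OF zero that] less smaller by blast
    moreover have "outcome SN S n = \<N>" if N: "outcome EP S n = \<N>"
    proof -
      have "options S n \<noteq> {}"
        using EP_outcome_terminal[OF zero, of n] N by auto
      then obtain s where "s \<in> options S n" "outcome EP S (n - s) \<in> {\<R>, \<P>}"
        using outcome_N_option[OF zero N] by blast
      then show ?thesis
        using SN_outcome_N[OF zero] assms(3) less smaller by blast
    qed
    ultimately show ?case by blast
  qed
qed

end
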